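(* Let $I\subset[0,\infty)$ be an interval, let $f:I\to\mathbb{R}$ be differentiable on the interior $I^{\circ}$, and let $a,b\in I^{\circ}$ with $a<b$ be such that $f'\in L[a,b]$. Suppose $|f'|^{q}$ is quasi-convex on $[a,b]$ for some fixed $q\geq1$. Let $x\in[a,b]$, $\lambda\in[0,1]$, $\alpha>0$. Then $$|S_{f}(x,\lambda,\alpha,a,b)|\leq A_{1}(\alpha,\lambda)\left\{\frac{(x-a)^{\alpha+1}}{b-a}\left(\sup\{|f'(x)|^{q},|f'(a)|^{q}\}\right)^{\frac1q}+\frac{(b-x)^{\alpha+1}}{b-a}\left(\sup\{|f'(x)|^{q},|f'(b)|^{q}\}\right)^{\frac1q}\right\},$$ where $$A_{1}(\alpha,\lambda)=\frac{2\alpha\lambda^{1+\frac1\alpha}+1}{\alpha+1}-\lambda.$$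
   Context: A function $g$ is quasi-convex on $[a,b]$ if $g(tu+(1-t)v)\le\sup\{g(u),g(v)\}$ for all $u,v\in[a,b]$, $t\in[0,1]$. $\Gamma$ is the Euler Gamma function. For $\alpha>0$ and $x\in[a,b]$: $J_{x^{-}}^{\alpha}f(a)=\frac{1}{\Gamma(\alpha)}\int_{a}^{x}(t-a)^{\alpha-1}f(t)\,dt$ and $J_{x^{+}}^{\alpha}f(b)=\frac{1}{\Gamma(\alpha)}\int_{x}^{b}(b-t)^{\alpha-1}f(t)\,dt$ (equal to $0$ when the interval of integration is a single point). Define $$S_{f}(x,\lambda,\alpha,a,b)=(1-\lambda)\frac{(x-a)^{\alpha}+(b-x)^{\alpha}}{b-a}f(x)+\lambda\frac{(x-a)^{\alpha}f(a)+(b-x)^{\alpha}f(b)}{b-a}-\frac{\Gamma(\alpha+1)}{b-a}\left[J_{x^{-}}^{\alpha}f(a)+J_{x^{+}}^{\alpha}f(b)\right].$$ *)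

theory Defs
  imports "HOL-Analysis.Analysis"
begin

definition quasi_convex_on :: "real set \<Rightarrow> (real \<Rightarrow> real) \<Rightarrow> bool" where
  "quasi_convex_on S g \<longleftrightarrow>
     (\<forall>u\<in>S. \<forall>v\<in>S. \<forall>t\<in>{0..1}. g (t * u + (1 - t) * v) \<le> Sup {g u, g v})"

(* Riemann-Liouville integrals of order alpha > 0.  With x the base point,
   rl_integral_minus alpha x f a is J_{x^-}^alpha f(a) for a \<le> x, and
   rl_integral_plus alpha x f b is J_{x^+}^alpha f(b) for x \<le> b.
   The convention 0 powr (alpha - 1) = 0 only affects one endpoint, a null set. *)

definition rl_integral_minus :: "real \<Rightarrow> real \<Rightarrow> (real \<Rightarrow> real) \<Rightarrow> real \<Rightarrow> real" where
  "rl_integral_minus \<alpha> x f a =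
     1 / Gamma \<alpha> * (LINT t:{a..x}|lebesgue. (t - a) powr (\<alpha> - 1) * f t)"

definition rl_integral_plus :: "real \<Rightarrow> real \<Rightarrow> (real \<Rightarrow> real) \<Rightarrow> real \<Rightarrow> real" where
  "rl_integral_plus \<alpha> x f b =
     1 / Gamma \<alpha> * (LINT t:{x..b}|lebesgue. (b - t) powr (\<alpha> - 1) * f t)"

definition S_frac ::
    "(real \<Rightarrow> real) \<Rightarrow> real \<Rightarrow> real \<Rightarrow> real \<Rightarrow> real \<Rightarrow> real \<Rightarrow> real" where
  "S_frac f x lam \<alpha> a b =
     (1 - lam) * (((x - a) powr \<alpha> + (b - x) powr \<alpha>) / (b - a)) * f x
     + lam * (((x - a) powr \<alpha> * f a + (b - x) powr \<alpha> * f b) / (b - a))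
     - Gamma (\<alpha> + 1) / (b - a) * (rl_integral_minus \<alpha> x f a + rl_integral_plus \<alpha> x f b)"

definition A1 :: "real \<Rightarrow> real \<Rightarrow> real" where
  "A1 \<alpha> lam = (2 * \<alpha> * lam powr (1 + 1 / \<alpha>) + 1) / (\<alpha> + 1) - lam"

end

theory Submission
  imports Defs
begin

text \<open>
  Write \<open>h = x - a\<close>. Integration by parts turns the part of \<open>S_frac\<close> that lives on
  \<open>[a, x]\<close> into \<open>\<integral> ((t - a)\<^sup>\<alpha> - \<lambda> h\<^sup>\<alpha>) f' t dt\<close>. Quasi-convexity bounds \<open>\<bar>f'\<bar>\<close> on \<open>[a, x]\<close> by its
  larger endpoint value, and the kernel changes sign at \<open>a + \<lambda>\<^bsup>1/\<alpha>\<^esup> h\<close>, so that its absolute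
  value integrates to \<open>A1 \<alpha> \<lambda> h\<^bsup>\<alpha>+1\<^esup>\<close>. The part on \<open>[x, b]\<close> follows by the reflection \<open>t \<mapsto> -t\<close>.
\<close>

text \<open>For negative \<open>\<beta>\<close> the integrand is unbounded near \<open>a\<close>, so
  when \<open>c = a\<close> it is not the derivative of its primitive at the left endpoint. Since
  \<open>\<beta> + 1 > 0\<close>, the primitive is still continuous there, and the interior form of
  the fundamental theorem applies.\<close>

lemma has_integral_powr_shifted:
  fixes a c d \<beta> :: real
  assumes "a \<le> c" "c \<le> d" "\<beta> > -1"
  shows "((\<lambda>t. (t - a) powr \<beta>) has_integral
           ((d - a) powr (\<beta> + 1) - (c - a) powr (\<beta> + 1)) / (\<beta> + 1)) {c..d}"
proof -
  have "((\<lambda>t. (t - a) powr \<beta>) has_integral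
      (d - a) powr (\<beta> + 1) / (\<beta> + 1) - (c - a) powr (\<beta> + 1) / (\<beta> + 1)) {c..d}"
  proof (rule fundamental_theorem_of_calculus_interior)
    show "continuous_on {c..d} (\<lambda>t. (t - a) powr (\<beta> + 1) / (\<beta> + 1))"
      using assms by (intro continuous_intros continuous_on_powr') auto
    show "((\<lambda>t. (t - a) powr (\<beta> + 1) / (\<beta> + 1)) has_vector_derivative (t - a) powr \<beta>) (at t)"
      if "t \<in> {c<..<d}" for t
    proof -
      have "((\<lambda>t. (t - a) powr (\<beta> + 1)) has_real_derivative (\<beta> + 1) * (t - a) powr \<beta>) (at t)"
        using assms that by (auto intro!: derivative_eq_intros)
      from DERIV_cdivide[OF this, of "\<beta> + 1"] show ?thesis
        unfolding has_real_derivative_iff_has_vector_derivative[symmetric] using assms by simp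
    qed
  qed fact
  then show ?thesis by (simp add: diff_divide_distrib)
qed

lemma has_integral_abs_kernel:
  fixes a x lam \<alpha> :: real
  assumes "a \<le> x" "lam \<in> {0..1}" "\<alpha> > 0"
  shows "((\<lambda>t. \<bar>(t - a) powr \<alpha> - lam * (x - a) powr \<alpha>\<bar>) has_integral
           A1 \<alpha> lam * (x - a) powr (\<alpha> + 1)) {a..x}"
proof -
  define h where "h = x - a"
  define s where "s = lam powr (1 / \<alpha>)"
  define c where "c = a + s * h"
  define m where "m = lam * h powr \<alpha>"
  have h: "h \<ge> 0" and s: "s \<in> {0..1}"
    using assms powr_mono2[of "1 / \<alpha>" lam 1] by (auto simp: h_def s_def)
  have c: "a \<le> c" "c \<le> x"
    using h s mult_right_mono[of s 1 h] by (auto simp: c_def h_def)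
  have s_powr: "s powr \<alpha> = lam"
    using assms by (simp add: s_def powr_powr)
  have m_eq: "m = (c - a) powr \<alpha>"
    using h s s_powr by (simp add: m_def c_def powr_mult)
  let ?k = "\<lambda>t. (t - a) powr \<alpha> - m"
  have k: "(?k has_integral
      ((v - a) powr (\<alpha> + 1) - (u - a) powr (\<alpha> + 1)) / (\<alpha> + 1) - m * (v - u)) {u..v}"
    if "a \<le> u" "u \<le> v" for u v
    using has_integral_diff[OF has_integral_powr_shifted[of a u v \<alpha>] has_integral_const_real[of m u v]]
      that assms by (simp add: mult.commute)
  \<comment> \<open>By \<open>m_eq\<close> the constant \<open>m\<close> is the value of the
    increasing power at \<open>c\<close>. The kernel is therefore nonpositive on
    \<open>{a..c}\<close> and nonnegative on \<open>{c..x}\<close>.\<close>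
  have "((\<lambda>t. \<bar>?k t\<bar>) has_integral
      - (((c - a) powr (\<alpha> + 1) - (a - a) powr (\<alpha> + 1)) / (\<alpha> + 1) - m * (c - a))) {a..c}"
    by (rule has_integral_eq[OF _ has_integral_neg[OF k[of a c]]])
      (use c assms in \<open>auto simp: m_eq powr_mono2\<close>)
  moreover have "((\<lambda>t. \<bar>?k t\<bar>) has_integral
      ((x - a) powr (\<alpha> + 1) - (c - a) powr (\<alpha> + 1)) / (\<alpha> + 1) - m * (x - c)) {c..x}"
    by (rule has_integral_eq[OF _ k[of c x]])
      (use c assms in \<open>auto simp: m_eq powr_mono2\<close>)
  ultimately have "((\<lambda>t. \<bar>?k t\<bar>) has_integral
      - (((c - a) powr (\<alpha> + 1) - (a - a) powr (\<alpha> + 1)) / (\<alpha> + 1) - m * (c - a))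
      + (((x - a) powr (\<alpha> + 1) - (c - a) powr (\<alpha> + 1)) / (\<alpha> + 1) - m * (x - c))) {a..x}"
    by (rule has_integral_combine[OF c])
  moreover have "- (((c - a) powr (\<alpha> + 1) - (a - a) powr (\<alpha> + 1)) / (\<alpha> + 1) - m * (c - a))
      + (((x - a) powr (\<alpha> + 1) - (c - a) powr (\<alpha> + 1)) / (\<alpha> + 1) - m * (x - c))
      = A1 \<alpha> lam * (x - a) powr (\<alpha> + 1)"
  proof -
    \<comment> \<open>In terms of \<open>H\<close>, \<open>h\<close>, \<open>s\<close> and
      \<open>lam\<close> the claim becomes a rational identity, with both sides multiples of
      \<open>H * h\<close>. Fact \<open>2\<close> has to be unfolded before \<open>4\<close>, which
      rewrites the \<open>c - a\<close> inside it.\<close>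
    define H where "H = h powr \<alpha>"
    have 1: "h powr (\<alpha> + 1) = H * h"
      using h by (auto simp: H_def powr_add)
    have 2: "(c - a) powr (\<alpha> + 1) = lam * s * H * h"
      using h s s_powr by (auto simp: H_def c_def powr_add powr_mult)
    have 3: "lam powr (1 + 1 / \<alpha>) = lam * s"
      using assms by (auto simp: s_def powr_add)
    have 4: "m = lam * H" "x - a = h" "c - a = s * h" "x - c = h - s * h"
      by (simp_all add: m_def H_def h_def c_def)
    have "\<alpha> + 1 \<noteq> 0" using assms by simp
    then show ?thesis
      unfolding A1_def 2 3 unfolding 4 1 by (simp add: divide_simps) (simp add: algebra_simps)
  qed
  ultimately show ?thesis by (simp add: m_def h_def)
qed

text \<open>The weight, possibly singular at \<open>a\<close>, is nonnegative, so its integrability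
  is absolute; the continuous factor is bounded and measurable on a compact interval. This lets the
  Lebesgue integrals of the definitions be treated as gauge integrals.\<close>

lemma absolutely_integrable_powr_mult:
  fixes f :: "real \<Rightarrow> real"
  assumes "continuous_on {a..x} f" "a \<le> x" "\<alpha> > 0"
  shows "(\<lambda>t. (t - a) powr (\<alpha> - 1) * f t) absolutely_integrable_on {a..x}"
proof -
  have "(\<lambda>t. (t - a) powr (\<alpha> - 1)) absolutely_integrable_on {a..x}"
    using has_integral_powr_shifted[of a a x "\<alpha> - 1"] assms
    by (intro nonnegative_absolutely_integrable_1) (auto simp: integrable_on_def)
  then have "(\<lambda>t. f t * (t - a) powr (\<alpha> - 1)) absolutely_integrable_on {a..x}"
    using assms
    by (intro absolutely_integrable_bounded_measurable_product_real
        continuous_imp_measurable_on_sets_lebesgue compact_imp_bounded compact_continuous_image) auto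
  then show ?thesis by (simp add: mult.commute)
qed

lemma left_part_bound:
  fixes f f' :: "real \<Rightarrow> real"
  assumes deriv: "\<And>t. t \<in> {a..x} \<Longrightarrow> (f has_real_derivative f' t) (at t)"
    and bound: "\<And>t. t \<in> {a..x} \<Longrightarrow> \<bar>f' t\<bar> \<le> M"
    and "a \<le> x" "lam \<in> {0..1}" "\<alpha> > 0"
  shows "\<bar>(x - a) powr \<alpha> * ((1 - lam) * f x + lam * f a)
            - \<alpha> * integral {a..x} (\<lambda>t. (t - a) powr (\<alpha> - 1) * f t)\<bar>
          \<le> A1 \<alpha> lam * (x - a) powr (\<alpha> + 1) * M"
proof -
  define k where "k t = (t - a) powr \<alpha> - lam * (x - a) powr \<alpha>" for t
  let ?w = "\<lambda>t. (t - a) powr (\<alpha> - 1) * f t"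
  have cont: "continuous_on {a..x} f"
    using deriv by (meson DERIV_isCont continuous_at_imp_continuous_on)
  \<comment> \<open>The integrand is the derivative of \<open>k t * f t\<close>. The constant
    subtracted in \<open>k\<close> is chosen for the boundary terms: \<open>k x\<close> is
    \<open>1 - lam\<close> times \<open>(x - a) powr \<alpha>\<close>, and \<open>- k a\<close> is
    \<open>lam\<close> times it.\<close>
  have parts: "((\<lambda>t. \<alpha> * ?w t + k t * f' t) has_integral k x * f x - k a * f a) {a..x}"
  proof (rule fundamental_theorem_of_calculus_interior)
    show "continuous_on {a..x} (\<lambda>t. k t * f t)"
      unfolding k_def using assms cont by (intro continuous_intros continuous_on_powr') auto
    show "((\<lambda>t. k t * f t) has_vector_derivative \<alpha> * ?w t + k t * f' t) (at t)"
      if "t \<in> {a<..<x}" for t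
      unfolding has_real_derivative_iff_has_vector_derivative[symmetric] k_def
      using that by (auto intro!: derivative_eq_intros deriv simp: algebra_simps)
  qed fact
  have w: "((\<lambda>t. \<alpha> * ?w t) has_integral \<alpha> * integral {a..x} ?w) {a..x}"
    by (intro has_integral_mult_right integrable_integral set_lebesgue_integral_eq_integral(1)
        absolutely_integrable_powr_mult cont assms)
  \<comment> \<open>Integrability of the product with \<open>f'\<close> is a result of this
    subtraction, with no continuity of \<open>f'\<close> involved.\<close>
  have kf: "((\<lambda>t. k t * f' t) has_integral
      k x * f x - k a * f a - \<alpha> * integral {a..x} ?w) {a..x}"
    using has_integral_diff[OF parts w] by simp
  have kM: "((\<lambda>t. \<bar>k t\<bar> * M) has_integral A1 \<alpha> lam * (x - a) powr (\<alpha> + 1) * M) {a..x}"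
    unfolding k_def using assms by (intro has_integral_mult_left has_integral_abs_kernel)
  have "norm (integral {a..x} (\<lambda>t. k t * f' t)) \<le> integral {a..x} (\<lambda>t. \<bar>k t\<bar> * M)"
    using kf kM bound
    by (intro integral_norm_bound_integral) (auto simp: integrable_on_def abs_mult mult_left_mono)
  then have "norm (k x * f x - k a * f a - \<alpha> * integral {a..x} ?w)
      \<le> A1 \<alpha> lam * (x - a) powr (\<alpha> + 1) * M"
    unfolding integral_unique[OF kf] integral_unique[OF kM] .
  moreover have "k x * f x - k a * f a = (x - a) powr \<alpha> * ((1 - lam) * f x + lam * f a)"
    using assms by (simp add: k_def algebra_simps)
  ultimately show ?thesis by simp
qed

lemma right_part_bound:
  fixes f f' :: "real \<Rightarrow> real"
  assumes deriv: "\<And>t. t \<in> {x..b} \<Longrightarrow> (f has_real_derivative f' t) (at t)"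
    and bound: "\<And>t. t \<in> {x..b} \<Longrightarrow> \<bar>f' t\<bar> \<le> M"
    and "x \<le> b" "lam \<in> {0..1}" "\<alpha> > 0"
  shows "\<bar>(b - x) powr \<alpha> * ((1 - lam) * f x + lam * f b)
            - \<alpha> * integral {x..b} (\<lambda>t. (b - t) powr (\<alpha> - 1) * f t)\<bar>
          \<le> A1 \<alpha> lam * (b - x) powr (\<alpha> + 1) * M"
proof -
  \<comment> \<open>After reflection \<open>- b\<close> is the left endpoint and \<open>- x\<close>
    the right one. The derivative changes sign, which leaves the bound on its absolute value
    intact.\<close>
  have "((\<lambda>t. f (- t)) has_real_derivative - f' (- t)) (at t)" if "t \<in> {- b..- x}" for t
    using deriv[of "- t"] that by (simp add: DERIV_mirror)
  then show ?thesis
    using left_part_bound[of "- b" "- x" "\<lambda>t. f (- t)" "\<lambda>t. - f' (- t)" M lam \<alpha>] assms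
      Henstock_Kurzweil_Integration.integral_reflect_real[of b x "\<lambda>t. (b - t) powr (\<alpha> - 1) * f t"]
    by (simp add: add.commute)
qed

text \<open>Apply quasi-convexity to the q-th power and take q-th roots. The unordered
  \<open>closed_segment\<close> allows \<open>u = x\<close> with \<open>v\<close> on either side, as
  both halves of the interval require.\<close>

lemma quasi_convex_on_abs_powr_bound:
  fixes g :: "real \<Rightarrow> real"
  assumes qc: "quasi_convex_on S (\<lambda>t. \<bar>g t\<bar> powr q)" and "q > 0"
    and "u \<in> S" "v \<in> S" "t \<in> closed_segment u v"
  shows "\<bar>g t\<bar> \<le> (Sup {\<bar>g u\<bar> powr q, \<bar>g v\<bar> powr q}) powr (1 / q)"
proof -
  obtain r where "0 \<le> r" "r \<le> 1" "t = (1 - r) * u + r * v"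
    using assms(5) by (auto simp: closed_segment_def)
  then have "1 - r \<in> {0..1}" "t = (1 - r) * u + (1 - (1 - r)) * v" by auto
  then have "\<bar>g t\<bar> powr q \<le> Sup {\<bar>g u\<bar> powr q, \<bar>g v\<bar> powr q}"
    using assms unfolding quasi_convex_on_def by blast
  then have "(\<bar>g t\<bar> powr q) powr (1 / q) \<le> (Sup {\<bar>g u\<bar> powr q, \<bar>g v\<bar> powr q}) powr (1 / q)"
    using \<open>q > 0\<close> by (intro powr_mono2) auto
  then show ?thesis using \<open>q > 0\<close> by (simp add: powr_powr)
qed

text \<open>These facts cancel the normalisation \<open>1 / Gamma \<alpha>\<close> against the
  factor \<open>Gamma (\<alpha> + 1)\<close> of \<open>S_frac\<close>, leaving
  \<open>\<alpha>\<close>.\<close>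

lemma Gamma_plus1_pos:
  fixes \<alpha> :: real
  assumes "\<alpha> > 0"
  shows "Gamma (\<alpha> + 1) = \<alpha> * Gamma \<alpha>" "Gamma \<alpha> \<noteq> 0"
proof -
  have "\<alpha> \<notin> \<int>\<^sub>\<le>\<^sub>0"
    using assms by (auto elim!: nonpos_Ints_cases)
  then show "Gamma (\<alpha> + 1) = \<alpha> * Gamma \<alpha>" "Gamma \<alpha> \<noteq> 0"
    by (simp_all add: Gamma_plus1 Gamma_eq_zero_iff)
qed

lemma rl_integral_minus_eq:
  assumes "continuous_on {a..x} f" "a \<le> x" "\<alpha> > 0"
  shows "Gamma (\<alpha> + 1) * rl_integral_minus \<alpha> x f a =
           \<alpha> * integral {a..x} (\<lambda>t. (t - a) powr (\<alpha> - 1) * f t)"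
  using set_lebesgue_integral_eq_integral(2)[OF absolutely_integrable_powr_mult[OF assms]] assms
  by (simp add: rl_integral_minus_def Gamma_plus1_pos)

lemma rl_integral_plus_eq:
  assumes "continuous_on {x..b} f" "x \<le> b" "\<alpha> > 0"
  shows "Gamma (\<alpha> + 1) * rl_integral_plus \<alpha> x f b =
           \<alpha> * integral {x..b} (\<lambda>t. (b - t) powr (\<alpha> - 1) * f t)"
proof -
  have "continuous_on {- b..- x} (\<lambda>t. f (- t))"
    by (intro continuous_on_compose2[OF assms(1)] continuous_intros) auto
  \<comment> \<open>The reflected integrand has its weight based at \<open>- b\<close>, which is the
    case already treated.\<close>
  from absolutely_integrable_powr_mult[OF this] assms
  have "(\<lambda>t. (b - t) powr (\<alpha> - 1) * f t) absolutely_integrable_on {x..b}"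
    using absolutely_integrable_reflect_real[of b x "\<lambda>t. (b - t) powr (\<alpha> - 1) * f t"]
    by (simp add: add.commute)
  from set_lebesgue_integral_eq_integral(2)[OF this] assms show ?thesis
    by (simp add: rl_integral_plus_def Gamma_plus1_pos)
qed

theorem theorem5:
  fixes I :: "real set" and f :: "real \<Rightarrow> real" and a b q x lam \<alpha> :: real
  assumes "is_interval I" and "I \<subseteq> {0..}"
    and "f differentiable_on interior I"
    and "a \<in> interior I" and "b \<in> interior I" and "a < b"
    and "set_integrable lebesgue {a..b} (deriv f)"
    and "q \<ge> 1"
    and "quasi_convex_on {a..b} (\<lambda>t. \<bar>deriv f t\<bar> powr q)"
    and "x \<in> {a..b}" and "lam \<in> {0..1}" and "\<alpha> > 0"
  shows "\<bar>S_frac f x lam \<alpha> a b\<bar> \<le>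
    A1 \<alpha> lam *
      ((x - a) powr (\<alpha> + 1) / (b - a)
         * (Sup {\<bar>deriv f x\<bar> powr q, \<bar>deriv f a\<bar> powr q}) powr (1 / q)
       + (b - x) powr (\<alpha> + 1) / (b - a)
         * (Sup {\<bar>deriv f x\<bar> powr q, \<bar>deriv f b\<bar> powr q}) powr (1 / q))"
proof -
  \<comment> \<open>The interior of an interval is convex, so all of \<open>{a..b}\<close> lies in
    it and \<open>f\<close> has a two-sided derivative even at \<open>a\<close> and
    \<open>b\<close>.\<close>
  have "closed_segment a b \<subseteq> interior I"
    using assms by (intro closed_segment_subset convex_interior) (auto simp: is_interval_convex_1)
  then have sub: "{a..b} \<subseteq> interior I"
    using \<open>a < b\<close> by (simp add: closed_segment_eq_real_ivl)
  have deriv: "(f has_real_derivative deriv f t) (at t)" if "t \<in> {a..b}" for t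
    using assms(3) sub that differentiable_on_eq_differentiable_at[OF open_interior, of f I]
    by (metis DERIV_deriv_iff_real_differentiable subsetD)
  then have cont: "continuous_on {a..b} f"
    by (meson DERIV_isCont continuous_at_imp_continuous_on)
  define Ma where "Ma = (Sup {\<bar>deriv f x\<bar> powr q, \<bar>deriv f a\<bar> powr q}) powr (1 / q)"
  define Mb where "Mb = (Sup {\<bar>deriv f x\<bar> powr q, \<bar>deriv f b\<bar> powr q}) powr (1 / q)"
  define P where "P = (x - a) powr \<alpha> * ((1 - lam) * f x + lam * f a)
      - \<alpha> * integral {a..x} (\<lambda>t. (t - a) powr (\<alpha> - 1) * f t)"
  define Q where "Q = (b - x) powr \<alpha> * ((1 - lam) * f x + lam * f b)
      - \<alpha> * integral {x..b} (\<lambda>t. (b - t) powr (\<alpha> - 1) * f t)"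
  have P: "\<bar>P\<bar> \<le> A1 \<alpha> lam * (x - a) powr (\<alpha> + 1) * Ma"
    unfolding P_def
  proof (rule left_part_bound)
    show "\<bar>deriv f t\<bar> \<le> Ma" if "t \<in> {a..x}" for t
      unfolding Ma_def using assms that
      by (intro quasi_convex_on_abs_powr_bound[where S = "{a..b}"])
        (auto simp: closed_segment_eq_real_ivl)
  qed (use assms deriv in auto)
  have Q: "\<bar>Q\<bar> \<le> A1 \<alpha> lam * (b - x) powr (\<alpha> + 1) * Mb"
    unfolding Q_def
  proof (rule right_part_bound)
    show "\<bar>deriv f t\<bar> \<le> Mb" if "t \<in> {x..b}" for t
      unfolding Mb_def using assms that
      by (intro quasi_convex_on_abs_powr_bound[where S = "{a..b}"])
        (auto simp: closed_segment_eq_real_ivl)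
  qed (use assms deriv in auto)
  \<comment> \<open>Sorting the terms by the powers of \<open>x - a\<close> and \<open>b - x\<close>
    separates the contributions of the two subintervals.\<close>
  have "S_frac f x lam \<alpha> a b = (1 / (b - a)) *
      ((x - a) powr \<alpha> * ((1 - lam) * f x + lam * f a) - Gamma (\<alpha> + 1) * rl_integral_minus \<alpha> x f a
     + ((b - x) powr \<alpha> * ((1 - lam) * f x + lam * f b) - Gamma (\<alpha> + 1) * rl_integral_plus \<alpha> x f b))"
    unfolding S_frac_def using \<open>a < b\<close> by (simp add: divide_simps) (simp add: algebra_simps)
  also have "\<dots> = (P + Q) / (b - a)"
  proof -
    have "continuous_on {a..x} f" "continuous_on {x..b} f"
      using assms by (auto intro: continuous_on_subset[OF cont])
    then show ?thesis
      using assms by (simp add: P_def Q_def rl_integral_minus_eq rl_integral_plus_eq)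
  qed
  finally have "\<bar>S_frac f x lam \<alpha> a b\<bar> = \<bar>P + Q\<bar> / (b - a)"
    using \<open>a < b\<close> by simp
  also have "\<dots> \<le> (A1 \<alpha> lam * (x - a) powr (\<alpha> + 1) * Ma
      + A1 \<alpha> lam * (b - x) powr (\<alpha> + 1) * Mb) / (b - a)"
    using P Q \<open>a < b\<close> by (intro divide_right_mono) auto
  also have "\<dots> = A1 \<alpha> lam * ((x - a) powr (\<alpha> + 1) / (b - a) * Ma
      + (b - x) powr (\<alpha> + 1) / (b - a) * Mb)"
    by (simp add: add_divide_distrib algebra_simps)
  finally show ?thesis unfolding Ma_def Mb_def .
qed

end
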